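(* Let $G$ be a graph with $n$ vertices and let $k\geq 1$ be an integer with $n\geq k+1$. If $G$ contains a Hamiltonian path, $n$ is even and $k$ is odd, then the $k$-token graph $F_k(G)$ contains a Hamiltonian path.
   Context: Graphs are finite, simple and undirected. For a graph $G$ and an integer $k\geq 1$, the $k$-token graph $F_k(G)$ is the graph whose vertices are the $k$-element subsets of $V(G)$, where two vertices $A,B$ are adjacent whenever their symmetric difference $A\triangle B$ is a pair $\{a,b\}$ with $a\in A$, $b\in B$ and $ab\in E(G)$. A Hamiltonian path is a path containing every vertex of the graph. *)

theory Defs
  imports "Graph_Theory.Pair_Digraph" "Graph_Theory.Vertex_Walk"
begin

text \<open>
  Finite simple undirected graphs are rendered by the locale \<^locale>\<open>pair_graph\<close>: an undirected
  edge \<open>ab\<close> is the pair of arcs \<open>(a, b)\<close> and \<open>(b, a)\<close>. In such a graph a \<^const>\<open>vpath\<close> (a nonempty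
  list of distinct vertices, consecutive ones adjacent) is exactly an undirected path.
\<close>

definition hamiltonian_path :: "'a list \<Rightarrow> ('a, 'b) pre_digraph \<Rightarrow> bool" where
  "hamiltonian_path p G \<longleftrightarrow> vpath p G \<and> verts G \<subseteq> set p"

definition token_verts :: "nat \<Rightarrow> 'a pair_pre_digraph \<Rightarrow> 'a set set" where
  "token_verts k G = {A. A \<subseteq> pverts G \<and> finite A \<and> card A = k}"

definition token_graph :: "nat \<Rightarrow> 'a pair_pre_digraph \<Rightarrow> 'a set pair_pre_digraph" where
  "token_graph k G =
    \<lparr> pverts = token_verts k G,
      parcs = {(A, B). A \<in> token_verts k G \<and> B \<in> token_verts k G \<and>
        (\<exists>a b. sym_diff A B = {a, b} \<and> a \<in> A \<and> b \<in> B \<and> (a, b) \<in> parcs G)} \<rparr>"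

lemma pair_graph_token_graph:
  assumes "pair_graph G"
  shows "pair_graph (token_graph k G)"
proof -
  interpret pair_graph G by fact
  have fin: "finite (token_verts k G)"
    by (rule finite_subset[of _ "Pow (pverts G)"]) (auto simp: token_verts_def)
  have sub: "parcs (token_graph k G) \<subseteq> token_verts k G \<times> token_verts k G"
    by (auto simp: token_graph_def)
  then have fin_arcs: "finite (parcs (token_graph k G))"
    using fin by (meson finite_SigmaI finite_subset)
  have G_sym: "(b, a) \<in> parcs G" if "(a, b) \<in> parcs G" for a b
    using that arcs_ends_symmetric[OF pair_sym_arcs] by simp
  have "sym (parcs (token_graph k G))"
  proof (rule symI)
    fix A B assume "(A, B) \<in> parcs (token_graph k G)"
    then obtain a b where *: "A \<in> token_verts k G" "B \<in> token_verts k G"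
      "sym_diff A B = {a, b}" "a \<in> A" "b \<in> B" "(a, b) \<in> parcs G"
      by (auto simp: token_graph_def)
    have "sym_diff B A = {b, a}"
      using *(3) by blast
    then have "\<exists>b a. sym_diff B A = {b, a} \<and> b \<in> B \<and> a \<in> A \<and> (b, a) \<in> parcs G"
      using *(4,5) G_sym[OF *(6)] by iprover
    then show "(B, A) \<in> parcs (token_graph k G)"
      unfolding token_graph_def using *(1,2) by simp
  qed
  then have "symmetric (with_proj (token_graph k G))"
    by (simp add: symmetric_def)
  moreover have "fst e \<in> pverts (token_graph k G)" "snd e \<in> pverts (token_graph k G)"
    if "e \<in> parcs (token_graph k G)" for e
  proof -
    have "pverts (token_graph k G) = token_verts k G"
      by (simp add: token_graph_def)
    then show "fst e \<in> pverts (token_graph k G)" "snd e \<in> pverts (token_graph k G)"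
      using that sub by (metis mem_Times_iff subsetD)+
  qed
  moreover have "fst e \<noteq> snd e" if "e \<in> parcs (token_graph k G)" for e
  proof
    assume "fst e = snd e"
    moreover from that have "\<exists>a b. sym_diff (fst e) (snd e) = {a, b}"
      unfolding token_graph_def by force
    ultimately show False
      by simp
  qed
  moreover have "finite (pverts (token_graph k G))"
    using fin by (simp add: token_graph_def)
  ultimately show ?thesis
    using fin_arcs by (intro pair_graph.intro pair_digraph.intro pair_pseudo_graph.intro
      pair_fin_digraph.intro pair_fin_digraph_axioms.intro pair_sym_digraph.intro
      pair_sym_digraph_axioms.intro pair_loopfree_digraph.intro pair_loopfree_digraph_axioms.intro
      pair_wf_digraph.intro)
qed

end

theory Submission
  imports Defs
begin

text \<open>
  Along a Hamiltonian path of \<open>G\<close> the configurations of \<open>k\<close> tokens become the bit strings with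
  \<open>s = n - k\<close> zeros and \<open>t = k\<close> ones, both odd, and it suffices to list these strings by swaps of
  adjacent bits, from \<open>0\<^sup>s1\<^sup>t\<close> to \<open>1\<^sup>t0\<^sup>s\<close>. Split them by their first two bits. The prefixes
  \<open>00\<close> and \<open>11\<close> leave instances of the same problem with \<open>s\<close> or \<open>t\<close> decreased by 2. The prefixes \<open>01\<close>
  and \<open>10\<close> together form the prism over the strings with \<open>s - 1\<close> zeros and \<open>t - 1\<close> ones, both even.
  This graph itself has no Hamiltonian path in general, but its prism does: split once more by the next
  two bits. The mixed prefixes give the product of a 4-cycle with a Hamiltonian path of a smaller odd
  instance, which can be traversed column by column; the prefixes \<open>00\<close> and \<open>11\<close> give smaller prisms,
  each of which is visited by a detour that replaces one rung of the first or of the last column.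
\<close>

section \<open>Bit strings under swaps of adjacent bits\<close>

text \<open>In bit strings, \<^term>\<open>True\<close> marks an occupied position.\<close>

fun swap_adj :: "bool list \<Rightarrow> bool list \<Rightarrow> bool" where
  "swap_adj (a # x) (b # y) \<longleftrightarrow>
    (a = b \<and> swap_adj x y) \<or> (a \<noteq> b \<and> (\<exists>z. x = b # z \<and> y = a # z))"
| "swap_adj _ _ \<longleftrightarrow> False"

lemma swap_adj_sym: "swap_adj x y \<Longrightarrow> swap_adj y x"
  by (induction x y rule: swap_adj.induct) auto

lemma swap_adj_append_left: "swap_adj x y \<Longrightarrow> swap_adj (u @ x) (u @ y)"
  by (induction u) auto

lemma swap_adj_map_Not: "swap_adj x y \<Longrightarrow> swap_adj (map Not x) (map Not y)"
  by (induction x y rule: swap_adj.induct) auto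

text \<open>The explicit form locates the swap, which the translation to tokens needs.\<close>

lemma swap_adjE:
  assumes "swap_adj x y"
  obtains u a v where "x = u @ a # (\<not> a) # v" "y = u @ (\<not> a) # a # v"
proof -
  have "\<exists>u a v. x = u @ a # (\<not> a) # v \<and> y = u @ (\<not> a) # a # v"
    using assms
  proof (induction x y rule: swap_adj.induct)
    case (1 a x b y)
    show ?case
    proof (cases "a = b")
      case True
      with 1 obtain u c v where "x = u @ c # (\<not> c) # v" "y = u @ (\<not> c) # c # v" by auto
      then have "a # x = (a # u) @ c # (\<not> c) # v \<and> b # y = (a # u) @ (\<not> c) # c # v"
        using True by simp
      then show ?thesis by blast
    next
      case False
      with 1 obtain z where "x = b # z" "y = a # z" by auto
      then have "a # x = [] @ a # (\<not> a) # z \<and> b # y = [] @ (\<not> a) # a # z"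
        using False by auto
      then show ?thesis by blast
    qed
  qed auto
  with that show ?thesis by blast
qed

section \<open>Hamiltonian paths with prescribed ends on sets of strings\<close>

definition ham_path :: "bool list set \<Rightarrow> bool list \<Rightarrow> bool list \<Rightarrow> bool" where
  "ham_path A x y \<longleftrightarrow> (\<exists>p. p \<noteq> [] \<and> distinct p \<and> set p = A \<and> successively swap_adj p
    \<and> hd p = x \<and> last p = y)"

lemma ham_path_singleton: "ham_path {x} x x"
  unfolding ham_path_def by (rule exI[of _ "[x]"]) simp

lemma ham_path_join:
  assumes "ham_path A x y" "ham_path B x' y'" "swap_adj y x'" "A \<inter> B = {}"
  shows "ham_path (A \<union> B) x y'"
proof -
  obtain p q where
    "p \<noteq> []" "distinct p" "set p = A" "successively swap_adj p" "hd p = x" "last p = y"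
    "q \<noteq> []" "distinct q" "set q = B" "successively swap_adj q" "hd q = x'" "last q = y'"
    using assms(1,2) unfolding ham_path_def by blast
  then show ?thesis
    using assms(3,4) unfolding ham_path_def
    by (intro exI[of _ "p @ q"]) (simp add: successively_append_iff)
qed

lemma ham_path_rev:
  assumes "ham_path A x y"
  shows "ham_path A y x"
proof -
  obtain p where "p \<noteq> []" "distinct p" "set p = A" "successively swap_adj p" "hd p = x" "last p = y"
    using assms unfolding ham_path_def by blast
  then show ?thesis
    unfolding ham_path_def
    by (intro exI[of _ "rev p"])
      (auto simp: hd_rev last_rev intro: successively_mono swap_adj_sym)
qed

lemma ham_path_image:
  assumes "ham_path A x y" "inj_on f A"
    and "\<And>x y. x \<in> A \<Longrightarrow> y \<in> A \<Longrightarrow> swap_adj x y \<Longrightarrow> swap_adj (f x) (f y)"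
  shows "ham_path (f ` A) (f x) (f y)"
proof -
  obtain p where "p \<noteq> []" "distinct p" "set p = A" "successively swap_adj p" "hd p = x" "last p = y"
    using assms(1) unfolding ham_path_def by blast
  then show ?thesis
    using assms(2,3) unfolding ham_path_def
    by (intro exI[of _ "map f p"])
      (auto simp: hd_map last_map distinct_map successively_map intro: successively_mono)
qed

lemma ham_path_prefix: "ham_path A x y \<Longrightarrow> ham_path ((@) u ` A) (u @ x) (u @ y)"
  by (erule ham_path_image) (simp_all add: inj_on_def swap_adj_append_left)

lemma ham_path_complement:
  "ham_path A x y \<Longrightarrow> ham_path (map Not ` A) (map Not x) (map Not y)"
proof (erule ham_path_image)
  show "inj_on (map Not) A"
    by (rule inj_on_subset[OF inj_mapI subset_UNIV]) (simp add: inj_def)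
qed (rule swap_adj_map_Not)

text \<open>A path can zigzag through a sequence of columns, the columns being crossed alternately from
  \<open>u\<close> to \<open>v\<close> and from \<open>v\<close> to \<open>u\<close>.\<close>

lemma ham_path_zigzag:
  assumes "ys \<noteq> []" "distinct ys" "successively swap_adj ys"
    and "\<And>y. y \<in> set ys \<Longrightarrow> ham_path (F y) (u @ y) (v @ y)"
    and "\<And>y y'. y \<in> set ys \<Longrightarrow> y' \<in> set ys \<Longrightarrow> y \<noteq> y' \<Longrightarrow> F y \<inter> F y' = {}"
  shows "ham_path (\<Union>y\<in>set ys. F y) (u @ hd ys) ((if even (length ys) then u else v) @ last ys)"
  using assms
proof (induction ys arbitrary: u v)
  case Nil
  then show ?case by simp
next
  case (Cons y ys)
  show ?case
  proof (cases "ys = []")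
    case True
    with Cons.prems show ?thesis by simp
  next
    case False
    \<comment> \<open>Past the first column the roles of \<open>u\<close> and \<open>v\<close> are
      exchanged, which is why both vary in the induction.\<close>
    have "ham_path (F y') (v @ y') (u @ y')" if "y' \<in> set ys" for y'
      by (rule ham_path_rev) (use Cons.prems(4) that in simp)
    then have IH: "ham_path (\<Union>y\<in>set ys. F y) (v @ hd ys)
        ((if even (length ys) then v else u) @ last ys)"
      using False Cons.prems(2,3,5) by (intro Cons.IH) (auto simp: successively_Cons)
    have "ham_path (F y) (u @ y) (v @ y)"
      using Cons.prems(4) by simp
    moreover note IH
    moreover have "swap_adj (v @ y) (v @ hd ys)"
      using False Cons.prems(3) by (intro swap_adj_append_left) (simp add: successively_Cons)
    moreover have "F y \<inter> (\<Union>y\<in>set ys. F y) = {}"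
      using Cons.prems(2,5) by fastforce
    ultimately have "ham_path (F y \<union> (\<Union>y\<in>set ys. F y)) (u @ y)
        ((if even (length ys) then v else u) @ last ys)"
      by (rule ham_path_join)
    then show ?thesis
      using False by (cases "even (length ys)") simp_all
  qed
qed

section \<open>Strings with given numbers of zeros and ones\<close>

definition config :: "nat \<Rightarrow> nat \<Rightarrow> bool list set" where
  "config s t = {x. count_list x False = s \<and> count_list x True = t}"

lemma length_eq_count_bool: "length x = count_list x False + count_list x True"
  by (induction x) auto

lemma config_0_left [simp]: "config 0 t = {replicate t True}"
proof -
  have "x = replicate (count_list x True) True" if "count_list x False = 0" for x
    using that by (induction x) (simp_all split: if_splits)
  moreover have "count_list (replicate t True) b = (if b then t else 0)" for b
    by (induction t) auto
  ultimately show ?thesis unfolding config_def by auto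
qed

text \<open>\<open>map Not\<close> exchanges the two counts and is its own inverse, so one
  inclusion, shown for all counts, gives both.\<close>

lemma config_complement: "map Not ` config s t = config t s"
proof -
  have "count_list (map Not x) b = count_list x (\<not> b)" for x b
    by (induction x) auto
  then have Not_config: "map Not x \<in> config t s" if "x \<in> config s t" for s t x
    using that by (simp add: config_def)
  have "x \<in> map Not ` config s t" if "x \<in> config t s" for x
    using Not_config[OF that] by (intro image_eqI[of _ _ "map Not x"]) (simp_all add: comp_def)
  then show ?thesis
    using Not_config by blast
qed

lemma config_0_right [simp]: "config s 0 = {replicate s False}"
  using config_complement[of 0 s] by simp

lemma config_Suc:
  "config (Suc s) (Suc t) = (#) False ` config s (Suc t) \<union> (#) True ` config (Suc s) t"
  (is "_ = ?R")
proof -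
  have "x \<in> ?R" if "x \<in> config (Suc s) (Suc t)" for x
    using that by (cases x) (auto simp: config_def split: if_splits)
  moreover have "?R \<subseteq> config (Suc s) (Suc t)"
    by (auto simp: config_def)
  ultimately show ?thesis by blast
qed


text \<open>Splitting by the first bit is Pascal's rule.\<close>

lemma card_config: "finite (config s t) \<and> card (config s t) = (s + t) choose t"
proof (induction "s + t" arbitrary: s t)
  case 0
  then show ?case by simp
next
  case (Suc n)
  show ?case
  proof (cases "s = 0 \<or> t = 0")
    case True
    then show ?thesis by auto
  next
    case False
    then obtain s' t' where st: "s = Suc s'" "t = Suc t'" by (metis not0_implies_Suc)
    then have IH: "finite (config s' t) \<and> card (config s' t) = (s' + t) choose t"
      "finite (config s t') \<and> card (config s t') = (s + t') choose t'"
      using Suc.hyps(1)[of s' t] Suc.hyps(1)[of s t'] Suc.hyps(2) by auto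
    have "(#) False ` config s' t \<inter> (#) True ` config s t' = {}" by auto
    then show ?thesis
      using IH st by (simp add: config_Suc card_Un_disjoint card_image)
  qed
qed

text \<open>The odd number \<open>t\<close> times the binomial coefficient equals the even number
  \<open>s + t\<close> times another coefficient.\<close>

lemma even_card_config:
  assumes "odd s" "odd t"
  shows "even (card (config s t))"
proof -
  obtain t' where t: "t = Suc t'" using assms(2) by (cases t) auto
  have "Suc t' * (Suc (s + t') choose Suc t') = Suc (s + t') * ((s + t') choose t')"
    by (rule Suc_times_binomial)
  moreover have "even (Suc (s + t'))" "odd (Suc t')"
    using assms t by auto
  ultimately have "even (Suc (s + t') choose Suc t')"
    by (metis even_mult_iff)
  then show ?thesis
    using t by (simp add: card_config)
qed

section \<open>Prisms over sets of strings\<close>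

abbreviation "TF \<equiv> [True, False]"
abbreviation "FT \<equiv> [False, True]"
abbreviation "TT \<equiv> [True, True]"
abbreviation "FF \<equiv> [False, False]"

text \<open>The Cartesian product with an edge: a swap between the two layers exchanges the first
  two bits and fixes the rest.\<close>

definition prism :: "bool list set \<Rightarrow> bool list set" where
  "prism A = (@) TF ` A \<union> (@) FT ` A"

lemma prism_Un: "prism (A \<union> B) = prism A \<union> prism B"
  by (auto simp: prism_def)

lemma prism_insert: "prism (insert x A) = {TF @ x, FT @ x} \<union> prism A"
  by (auto simp: prism_def)

lemma mem_prism: "x \<in> prism A \<longleftrightarrow> (\<exists>y\<in>A. x = TF @ y \<or> x = FT @ y)"
  by (auto simp: prism_def)

lemma prism_disjoint: "A \<inter> B = {} \<Longrightarrow> prism A \<inter> prism B = {}"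
  by (auto simp: prism_def)

lemma prism_complement: "map Not ` prism A = prism (map Not ` A)"
  by (simp add: prism_def image_Un image_image Un_commute)

lemma ham_path_rung: "ham_path (prism {x}) (TF @ x) (FT @ x)"
  using ham_path_join[OF ham_path_singleton ham_path_singleton, of "TF @ x" "FT @ x"]
  by (simp add: prism_def insert_commute)

text \<open>\<open>?f\<close> inserts \<open>u\<close> behind the two prism bits. No swap inside a
  prism exchanges the second and third bits, so every swap survives.\<close>

lemma ham_path_prism_prefix:
  assumes "ham_path (prism A) (TF @ x) (FT @ x)"
  shows "ham_path (prism ((@) u ` A)) (TF @ u @ x) (FT @ u @ x)"
proof -
  let ?f = "\<lambda>w. take 2 w @ u @ drop 2 w"
  have "ham_path (?f ` prism A) (?f (TF @ x)) (?f (FT @ x))"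
    using assms
  proof (rule ham_path_image)
    show "inj_on ?f (prism A)"
      by (rule inj_onI) (auto simp: mem_prism)
    fix w w' assume "w \<in> prism A" "w' \<in> prism A" "swap_adj w w'"
    then show "swap_adj (?f w) (?f w')"
      by (auto simp: mem_prism intro: swap_adj_append_left)
  qed
  moreover have "?f ` prism A = prism ((@) u ` A)"
    by (simp add: prism_def image_Un image_image)
  ultimately show ?thesis by simp
qed

text \<open>A rung of a prism can be replaced by a detour through a smaller prism.\<close>

lemma ham_path_detour_TT:
  assumes "ham_path (prism A) (TF @ False # z) (FT @ False # z)"
  shows "ham_path (prism (insert (TF @ True # z) ((@) TT ` A)))
    (TF @ TF @ True # z) (FT @ TF @ True # z)"
proof -
  \<comment> \<open>\<open>TF @ True # z\<close> and \<open>TT @ False # z\<close> differ by a swap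
    of the second and third bits, so both ends of the rung are adjacent to ends of the inner
    path.\<close>
  have "ham_path ({TF @ TF @ True # z} \<union> prism ((@) TT ` A) \<union> {FT @ TF @ True # z})
    (TF @ TF @ True # z) (FT @ TF @ True # z)"
    by (intro ham_path_join[OF ham_path_join[OF ham_path_singleton ham_path_prism_prefix[OF assms]]
          ham_path_singleton]) (auto simp: mem_prism)
  then show ?thesis
    by (simp add: prism_insert insert_commute)
qed

lemma ham_path_detour_FF:
  assumes "ham_path (prism A) (TF @ True # z) (FT @ True # z)"
  shows "ham_path (prism (insert (FT @ False # z) ((@) FF ` A)))
    (TF @ FT @ False # z) (FT @ FT @ False # z)"
proof -
  \<comment> \<open>The same swap links \<open>FT @ False # z\<close> to
    \<open>FF @ True # z\<close>.\<close>
  have "ham_path ({TF @ FT @ False # z} \<union> prism ((@) FF ` A) \<union> {FT @ FT @ False # z})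
    (TF @ FT @ False # z) (FT @ FT @ False # z)"
    by (intro ham_path_join[OF ham_path_join[OF ham_path_singleton ham_path_prism_prefix[OF assms]]
          ham_path_singleton]) (auto simp: mem_prism)
  then show ?thesis
    by (simp add: prism_insert insert_commute)
qed

lemma config_Suc_Suc:
  "config (Suc (Suc s)) (Suc (Suc t)) =
    (@) TT ` config (Suc (Suc s)) t \<union> prism (config (Suc s) (Suc t)) \<union> (@) FF ` config s (Suc (Suc t))"
  (is "_ = ?R")
proof -
  have "x \<in> ?R" if "x \<in> config (Suc (Suc s)) (Suc (Suc t))" for x
  proof -
    from that have "length x \<ge> 2" by (simp add: config_def length_eq_count_bool)
    then obtain a b y where x: "x = a # b # y"
      by (cases x; cases "tl x") auto
    show ?thesis
      using that by (cases a; cases b) (auto simp: x config_def prism_def)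
  qed
  moreover have "?R \<subseteq> config (Suc (Suc s)) (Suc (Suc t))"
    by (auto simp: config_def prism_def)
  ultimately show ?thesis by blast
qed


text \<open>Both prism constructions treat the first string apart; distinct ends keep the remaining
  list nonempty.\<close>

lemma ham_path_ConsE:
  assumes "ham_path A x y" "x \<noteq> y"
  obtains q where "q \<noteq> []" "distinct (x # q)" "set (x # q) = A" "successively swap_adj (x # q)"
    "last q = y"
proof -
  obtain p where p: "p \<noteq> []" "distinct p" "set p = A" "successively swap_adj p" "hd p = x" "last p = y"
    using assms(1) unfolding ham_path_def by blast
  then obtain q where q: "p = x # q" by (cases p) auto
  with p assms(2) have "q \<noteq> []" by auto
  with p q that show thesis by simp
qed

section \<open>Base cases with a single one or a single zero\<close>

text \<open>The only one moves from left to right; after its first step all strings begin with a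
  zero and induction takes over.\<close>

lemma ham_path_config_1: "ham_path (config s 1) (True # replicate s False) (replicate s False @ [True])"
proof (induction s)
  case 0
  then show ?case by (simp add: ham_path_singleton)
next
  case (Suc s)
  have "ham_path ({True # replicate (Suc s) False} \<union> (@) [False] ` config s 1)
      (True # replicate (Suc s) False) ([False] @ replicate s False @ [True])"
    by (rule ham_path_join[OF ham_path_singleton ham_path_prefix[OF Suc.IH]]) auto
  moreover have "(@) [False] ` config s 1 = (#) False ` config s 1" by simp
  ultimately show ?case
    by (simp add: config_Suc Un_commute)
qed

lemma ham_path_1_config: "ham_path (config 1 t) (replicate t True @ [False]) (False # replicate t True)"
  using ham_path_rev[OF ham_path_complement[OF ham_path_config_1[of t]]]
  by (simp add: config_complement)

section \<open>Extremal paths and prism paths\<close>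

definition extremal_path :: "nat \<Rightarrow> nat \<Rightarrow> bool" where
  "extremal_path s t \<longleftrightarrow> ham_path (config s t)
    (replicate s False @ replicate t True) (replicate t True @ replicate s False)"

text \<open>Meant for even \<open>s\<close> and odd \<open>t\<close>, so that both counts in the
  base are even. The ends form a rung whose base begins with a one, which is where an
  \<open>FF\<close> detour attaches.\<close>

definition prism_path :: "nat \<Rightarrow> nat \<Rightarrow> bool" where
  "prism_path s t \<longleftrightarrow> ham_path (prism (config s (Suc t)))
    (TF @ True # replicate s False @ replicate t True)
    (FT @ True # replicate s False @ replicate t True)"

text \<open>Complementation also exchanges \<open>TF\<close> and \<open>FT\<close>; reversal
  restores the order of the ends.\<close>

lemma prism_path_complement:
  assumes "prism_path s t"
  shows "ham_path (prism (config (Suc t) s))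
    (TF @ False # replicate s True @ replicate t False)
    (FT @ False # replicate s True @ replicate t False)"
  using ham_path_rev[OF ham_path_complement[OF assms[unfolded prism_path_def]]]
  by (simp add: prism_complement config_complement)

text \<open>The detour is attached at \<open>TF\<close> followed by the final string of
  \<open>extremal_path (Suc s) (Suc t)\<close>.\<close>

lemma detour_TT_config:
  assumes "prism_path t (Suc s)"
  shows "ham_path (prism (insert (TF @ replicate (Suc t) True @ replicate (Suc s) False)
      ((@) TT ` config (Suc (Suc s)) t)))
    (TF @ TF @ replicate (Suc t) True @ replicate (Suc s) False)
    (FT @ TF @ replicate (Suc t) True @ replicate (Suc s) False)"
  using ham_path_detour_TT[OF prism_path_complement[OF assms]] by simp

text \<open>Dually, this detour is attached at \<open>FT\<close> followed by the initial
  string.\<close>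

lemma detour_FF_config:
  assumes "prism_path s (Suc t)"
  shows "ham_path (prism (insert (FT @ replicate (Suc s) False @ replicate (Suc t) True)
      ((@) FF ` config s (Suc (Suc t)))))
    (TF @ FT @ replicate (Suc s) False @ replicate (Suc t) True)
    (FT @ FT @ replicate (Suc s) False @ replicate (Suc t) True)"
  using ham_path_detour_FF[OF assms[unfolded prism_path_def]] by simp

text \<open>With \<open>y\<close> and \<open>z\<close> the ends of the smaller Hamiltonian path, the prism over the closed walk
  \<open>10y, \<dots>, 10z, 01z, \<dots>, 01y\<close> is traversed by a zigzag that starts and ends at the rung of \<open>10y\<close>;
  the rungs of \<open>10z\<close> and \<open>01y\<close> carry the detours.\<close>

lemma prism_path_step:
  assumes "extremal_path (Suc s) (Suc t)" "prism_path t (Suc s)" "prism_path s (Suc t)"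
  shows "prism_path (Suc (Suc s)) (Suc t)"
proof -
  define y z where "y = replicate (Suc s) False @ replicate (Suc t) True"
    and "z = replicate (Suc t) True @ replicate (Suc s) False"
  define A B where "A = (@) TT ` config (Suc (Suc s)) t" and "B = (@) FF ` config s (Suc (Suc t))"
  have yz: "y \<noteq> z" by (simp add: y_def z_def)
  obtain q where q: "q \<noteq> []" "distinct (y # q)" "set (y # q) = config (Suc s) (Suc t)"
      "successively swap_adj (y # q)" "last q = z"
    using ham_path_ConsE[OF assms(1)[unfolded extremal_path_def, folded y_def z_def] yz] by blast
  define G where "G l = insert l ((if l = TF @ z then A else {}) \<union> (if l = FT @ y then B else {}))" for l
  \<comment> \<open>The closed walk without \<open>TF @ y\<close>, whose rung is split to supply
    both ends of the final path.\<close>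
  define ls where "ls = map ((@) TF) q @ map ((@) FT) (rev (y # q))"
  have G_path: "ham_path (prism (G l)) (TF @ l) (FT @ l)" for l
  proof -
    consider "l = TF @ z" | "l = FT @ y" | "l \<noteq> TF @ z" "l \<noteq> FT @ y" by blast
    then show ?thesis
    proof cases
      case 1
      then show ?thesis
        using detour_TT_config[OF assms(2), folded z_def A_def] by (simp add: G_def)
    next
      case 2
      then show ?thesis
        using detour_FF_config[OF assms(3), folded y_def B_def] by (simp add: G_def)
    next
      case 3
      then show ?thesis
        using ham_path_rung[of l] by (simp add: G_def)
    qed
  qed
  have ls_mem: "(\<exists>x. l = TF @ x) \<or> (\<exists>x. l = FT @ x)" if "l \<in> set ls" for l
    using that by (auto simp: ls_def)
  have A_mem: "\<exists>x. l = TT @ x" if "l \<in> A" for l using that by (auto simp: A_def)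
  have B_mem: "\<exists>x. l = FF @ x" if "l \<in> B" for l using that by (auto simp: B_def)
  have G_disjoint: "G l \<inter> G l' = {}" if "l \<in> set ls" "l' \<in> set ls" "l \<noteq> l'" for l l'
    using ls_mem[OF that(1)] ls_mem[OF that(2)] that(3)
    by (auto simp: G_def split: if_splits dest!: A_mem B_mem)
  have "ham_path (\<Union>l\<in>set ls. prism (G l)) (TF @ hd ls)
      ((if even (length ls) then TF else FT) @ last ls)"
  proof (rule ham_path_zigzag)
    show "ls \<noteq> []" by (simp add: ls_def)
    show "distinct ls"
      using q(2) by (auto simp: ls_def distinct_map inj_on_def)
    have "successively (\<lambda>a b. swap_adj (u @ a) (u @ b)) (y # q)" for u
      by (rule successively_mono[OF q(4)]) (rule swap_adj_append_left)
    then have succ: "successively swap_adj (map ((@) u) (y # q))" for u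
      by (simp only: successively_map)
    then have succ_rev: "successively swap_adj (rev (map ((@) u) (y # q)))" for u
      unfolding successively_rev by (rule successively_mono) (rule swap_adj_sym)
    have "successively swap_adj (map ((@) TF) q)"
      using succ[of TF] by (cases q) auto
    moreover have "last (map ((@) TF) q) = TF @ z" "hd (map ((@) FT) (rev (y # q))) = FT @ z"
      using q(1,5) by (simp_all add: last_map hd_map hd_rev)
    ultimately show "successively swap_adj ls"
      unfolding ls_def using succ_rev[of FT] by (simp add: successively_append_iff rev_map)
  qed (use G_path G_disjoint in \<open>auto intro!: prism_disjoint\<close>)
  \<comment> \<open>There are \<open>2 * length q + 1\<close> columns, so the zigzag ends at
    \<open>FT @ FT @ y\<close>, a neighbour of the missing \<open>FT @ TF @ y\<close>.\<close>
  moreover have "odd (length ls)" by (simp add: ls_def)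
  moreover have "hd ls = TF @ hd q" "last ls = FT @ y"
    using q(1) by (simp_all add: ls_def hd_map last_map)
  moreover have "(\<Union>l\<in>set ls. prism (G l)) = prism (\<Union>l\<in>set ls. G l)"
    by (auto simp: prism_def)
  ultimately have path: "ham_path (prism (\<Union>l\<in>set ls. G l)) (TF @ TF @ hd q) (FT @ FT @ y)"
    by simp
  have y_new: "TF @ y \<notin> (\<Union>l\<in>set ls. G l)"
    using q(2) yz by (auto simp: G_def ls_def split: if_splits dest!: A_mem B_mem)
  have "swap_adj y (hd q)"
    using q(1,4) by (simp add: successively_Cons)
  then have "swap_adj (TF @ TF @ y) (TF @ TF @ hd q)"
    by (intro swap_adj_append_left)
  then have "ham_path ({TF @ TF @ y} \<union> prism (\<Union>l\<in>set ls. G l) \<union> {FT @ TF @ y})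
      (TF @ TF @ y) (FT @ TF @ y)"
    using y_new
    by (intro ham_path_join[OF ham_path_join[OF ham_path_singleton path] ham_path_singleton])
      (auto simp: mem_prism)
  moreover have "{TF @ TF @ y} \<union> prism (\<Union>l\<in>set ls. G l) \<union> {FT @ TF @ y}
      = prism (insert (TF @ y) (\<Union>l\<in>set ls. G l))"
    by (auto simp: prism_insert)
  moreover have "insert (TF @ y) (\<Union>l\<in>set ls. G l) = config (Suc (Suc s)) (Suc (Suc t))"
  proof -
    have z: "z \<in> set q" using q(1,5) last_in_set by metis
    then have "TF @ z \<in> set ls" "FT @ y \<in> set ls"
      by (auto simp: ls_def)
    then have "(\<Union>l\<in>set ls. G l) = set ls \<union> A \<union> B"
      unfolding G_def by (auto split: if_splits)
    then have "insert (TF @ y) (\<Union>l\<in>set ls. G l) = A \<union> insert (TF @ y) (set ls) \<union> B"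
      by blast
    also have "insert (TF @ y) (set ls) = prism (set (y # q))"
      by (auto simp: ls_def prism_def)
    finally show ?thesis
      unfolding config_Suc_Suc A_def B_def q(3) .
  qed
  ultimately show ?thesis
    by (simp add: prism_path_def y_def)
qed

text \<open>Induction down to a single rung. Extremal paths are assumed only for smaller totals, so
  the lemma can be applied inside the induction for \<open>extremal_path\<close>.\<close>

lemma prism_pathI:
  assumes "even s" "odd t"
    and "\<And>s' t'. odd s' \<Longrightarrow> odd t' \<Longrightarrow> s' + t' < s + t \<Longrightarrow> extremal_path s' t'"
  shows "prism_path s t"
  using assms
proof (induction "s + t" arbitrary: s t rule: less_induct)
  case less
  show ?case
  proof (cases "s = 0")
    case True
    then show ?thesis
      using ham_path_rung[of "replicate (Suc t) True"] by (simp add: prism_path_def)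
  next
    case False
    with less.prems(1) obtain s' where s: "s = Suc (Suc s')" "even s'"
      by (cases s; cases "s - 1") auto
    from less.prems(2) obtain t' where t: "t = Suc t'" "even t'"
      by (cases t) auto
    show ?thesis
      unfolding s(1) t(1)
      by (intro prism_path_step less.prems(3) less.hyps) (use s t in auto)
  qed
qed

text \<open>The 4-cycle columns are crossed one after the other. The column of \<open>y\<close> is left with its first two
  bits swapped, every other column with its third and fourth bits swapped. The number of columns is
  even, so the path ends at the antipode of the point of the 4-cycle where it started.\<close>

lemma crossing_path:
  assumes "extremal_path (Suc s) (Suc t)" "prism_path t (Suc s)" "prism_path s (Suc t)"
    and "even s" "even t"
  shows "ham_path (prism (config (Suc (Suc s)) (Suc (Suc t))))
    (TF @ TF @ replicate (Suc s) False @ replicate (Suc t) True)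
    (FT @ FT @ replicate (Suc t) True @ replicate (Suc s) False)"
proof -
  define y z where "y = replicate (Suc s) False @ replicate (Suc t) True"
    and "z = replicate (Suc t) True @ replicate (Suc s) False"
  define A B where "A = (@) TT ` config (Suc (Suc s)) t" and "B = (@) FF ` config s (Suc (Suc t))"
  have yz: "y \<noteq> z" by (simp add: y_def z_def)
  obtain q where q: "q \<noteq> []" "distinct (y # q)" "set (y # q) = config (Suc s) (Suc t)"
      "successively swap_adj (y # q)" "last q = z"
    using ham_path_ConsE[OF assms(1)[unfolded extremal_path_def, folded y_def z_def] yz] by blast
  have "even (length (y # q))"
    using even_card_config[of "Suc s" "Suc t"] assms(4,5) distinct_card[OF q(2)] q(3) by simp
  \<comment> \<open>With the column of \<open>y\<close> set aside, an odd number of columns remains,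
    so their zigzag ends on the \<open>FT @ FT\<close> side.\<close>
  then have odd_q: "odd (length q)" by simp
  \<comment> \<open>The 4-cycle of \<open>x\<close>, opened between \<open>FT @ TF\<close> and
    \<open>FT @ FT\<close>; for \<open>x = z\<close> the rung at \<open>TF @ z\<close> is replaced
    by the detour through \<open>A\<close>.\<close>
  define F where "F x = prism (insert (TF @ x) (if x = z then A else {})) \<union> prism {FT @ x}" for x
  have A_mem: "\<exists>x. l = TT @ x" if "l \<in> A" for l using that by (auto simp: A_def)
  have B_mem: "\<exists>x. l = FF @ x" if "l \<in> B" for l using that by (auto simp: B_def)
  have F_path: "ham_path (F x) ((FT @ TF) @ x) ((FT @ FT) @ x)" for x
  proof -
    have "ham_path (prism (insert (TF @ x) (if x = z then A else {}))) (TF @ TF @ x) (FT @ TF @ x)"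
      using detour_TT_config[OF assms(2), folded z_def A_def] ham_path_rung by simp
    moreover have "prism (insert (TF @ x) (if x = z then A else {})) \<inter> prism {FT @ x} = {}"
      by (intro prism_disjoint) (auto dest!: A_mem split: if_splits)
    ultimately show ?thesis
      using ham_path_join[OF ham_path_rev ham_path_rung[of "FT @ x"]] by (simp add: F_def)
  qed
  have "ham_path (\<Union>x\<in>set q. F x) ((FT @ TF) @ hd q)
      ((if even (length q) then FT @ TF else FT @ FT) @ last q)"
  proof (rule ham_path_zigzag)
    show "successively swap_adj q" using q(4) by (cases q) auto
    show "F x \<inter> F x' = {}" if "x \<noteq> x'" for x x'
      using that unfolding F_def
      by (auto simp: mem_prism dest!: A_mem split: if_splits)
  qed (use q F_path in auto)
  then have path: "ham_path (\<Union>x\<in>set q. F x) (FT @ TF @ hd q) (FT @ FT @ z)"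
    using odd_q q(5) by simp
  have FF_path: "ham_path (prism (insert (FT @ y) B)) (TF @ FT @ y) (FT @ FT @ y)"
    using detour_FF_config[OF assms(3), folded y_def B_def] .
  \<comment> \<open>The 4-cycle of \<open>y\<close> is opened between \<open>TF @ TF\<close> and
    \<open>FT @ TF\<close> instead; its rung at \<open>FT @ y\<close> carries the detour through
    \<open>B\<close>.\<close>
  have "ham_path ({TF @ TF @ y} \<union> prism (insert (FT @ y) B) \<union> {FT @ TF @ y})
      (TF @ TF @ y) (FT @ TF @ y)"
    by (intro ham_path_join[OF ham_path_join[OF ham_path_singleton FF_path] ham_path_singleton])
      (auto simp: mem_prism dest!: B_mem)
  moreover have "{TF @ TF @ y} \<union> prism (insert (FT @ y) B) \<union> {FT @ TF @ y}
      = prism ({TF @ y, FT @ y} \<union> B)"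
    by (auto simp: prism_def)
  ultimately have start: "ham_path (prism ({TF @ y, FT @ y} \<union> B)) (TF @ TF @ y) (FT @ TF @ y)"
    by simp
  have "swap_adj y (hd q)"
    using q(1,4) by (simp add: successively_Cons)
  then have adj: "swap_adj (FT @ TF @ y) (FT @ TF @ hd q)"
    by (intro swap_adj_append_left)
  have disj: "prism ({TF @ y, FT @ y} \<union> B) \<inter> (\<Union>x\<in>set q. F x) = {}"
    using q(2) yz by (auto simp: F_def mem_prism dest!: A_mem B_mem split: if_splits)
  have "(\<Union>x\<in>set q. F x) = prism (prism (set q) \<union> A)"
  proof -
    have z: "z \<in> set q" using q(1,5) last_in_set by metis
    then have "(\<Union>x\<in>set q. insert (TF @ x) (if x = z then A else {}) \<union> {FT @ x}) = prism (set q) \<union> A"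
      by (auto simp: prism_def split: if_splits)
    moreover have "(\<Union>x\<in>set q. F x)
        = prism (\<Union>x\<in>set q. insert (TF @ x) (if x = z then A else {}) \<union> {FT @ x})"
      unfolding F_def by (auto simp: prism_def)
    ultimately show ?thesis by simp
  qed
  moreover have "{TF @ y, FT @ y} \<union> B \<union> (prism (set q) \<union> A) = config (Suc (Suc s)) (Suc (Suc t))"
    unfolding config_Suc_Suc A_def B_def q(3)[symmetric] by (auto simp: prism_def)
  ultimately show ?thesis
    using ham_path_join[OF start path adj disj] unfolding y_def z_def
    by (simp add: prism_Un[symmetric])
qed

section \<open>Induction for odd numbers of zeros and ones\<close>

lemma extremal_pathI:
  assumes "odd s" "odd t"
  shows "extremal_path s t"
  using assms
proof (induction "s + t" arbitrary: s t rule: less_induct)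
  case less
  consider "s = 1" | "t = 1" | "s \<noteq> 1" "t \<noteq> 1" by blast
  then show ?case
  proof cases
    case 1
    then show ?thesis
      using ham_path_rev[OF ham_path_1_config[of t]] by (simp add: extremal_path_def)
  next
    case 2
    then show ?thesis
      using ham_path_rev[OF ham_path_config_1[of s]] by (simp add: extremal_path_def)
  next
    case 3
    obtain a where a: "s = Suc (Suc a)" "odd a"
      using less.prems(1) 3(1) by (cases s; cases "s - 1") auto
    obtain b where b: "t = Suc (Suc b)" "odd b"
      using less.prems(2) 3(2) by (cases t; cases "t - 1") auto
    obtain a' where a': "a = Suc a'" "even a'" using a(2) by (cases a) auto
    obtain b' where b': "b = Suc b'" "even b'" using b(2) by (cases b) auto
    have H: "extremal_path s' t'" if "odd s'" "odd t'" "s' + t' < s + t" for s' t'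
      by (rule less.hyps) (use that in simp_all)
    \<comment> \<open>The mixed prefixes leave the even counts \<open>Suc a\<close> and
      \<open>Suc b\<close>, out of reach of the induction hypothesis.\<close>
    have mid: "ham_path (prism (config (Suc a) (Suc b)))
        (TF @ TF @ replicate a False @ replicate b True)
        (FT @ FT @ replicate b True @ replicate a False)"
      unfolding a'(1) b'(1)
    proof (rule crossing_path)
      show "extremal_path (Suc a') (Suc b')"
        using a b a' b' by (intro H) auto
      show "prism_path b' (Suc a')"
        using a b a' b' by (intro prism_pathI H) auto
      show "prism_path a' (Suc b')"
        using a b a' b' by (intro prism_pathI H) auto
    qed fact+
    have TT: "ham_path ((@) TT ` config s b) (TT @ replicate b True @ replicate s False)
        (TT @ replicate s False @ replicate b True)"
    proof -
      have "extremal_path s b"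
        by (rule H) (use less.prems a b in auto)
      from ham_path_prefix[OF ham_path_rev[OF this[unfolded extremal_path_def]], of TT]
      show ?thesis .
    qed
    have FF: "ham_path ((@) FF ` config a t) (FF @ replicate t True @ replicate a False)
        (FF @ replicate a False @ replicate t True)"
    proof -
      have "extremal_path a t"
        by (rule H) (use less.prems a b in auto)
      from ham_path_prefix[OF ham_path_rev[OF this[unfolded extremal_path_def]], of FF]
      show ?thesis .
    qed
    have "ham_path ((@) TT ` config s b \<union> prism (config (Suc a) (Suc b)) \<union> (@) FF ` config a t)
        (TT @ replicate b True @ replicate s False) (FF @ replicate a False @ replicate t True)"
    proof (rule ham_path_join[OF ham_path_join[OF TT mid] FF])
      \<comment> \<open>Both transitions swap the second and third bits: from \<open>TT @ FF\<close>
        to \<open>TF @ TF\<close>, and from \<open>FT @ FT\<close> to \<open>FF @ TT\<close>. This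
        dictates the antipodal ends of the middle block.\<close>
      show "swap_adj (TT @ replicate s False @ replicate b True)
          (TF @ TF @ replicate a False @ replicate b True)"
        by (simp add: a(1))
      show "swap_adj (FT @ FT @ replicate b True @ replicate a False)
          (FF @ replicate t True @ replicate a False)"
        by (simp add: b(1))
    qed (auto simp: mem_prism)
    then have "ham_path (config s t) (TT @ replicate b True @ replicate s False)
        (FF @ replicate a False @ replicate t True)"
      unfolding a(1) b(1) config_Suc_Suc .
    from ham_path_rev[OF this] show ?thesis
      by (simp add: extremal_path_def a(1) b(1))
  qed
qed


section \<open>From bit strings to sets of tokens\<close>

definition tokens :: "'a list \<Rightarrow> bool list \<Rightarrow> 'a set" where
  "tokens p x = {v. (v, True) \<in> set (zip p x)}"

lemma tokens_subset: "tokens p x \<subseteq> set p"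
  by (auto simp: tokens_def dest: set_zip_leftD)

lemma tokens_Cons: "tokens (v # p) (b # x) = (if b then insert v (tokens p x) else tokens p x)"
  by (auto simp: tokens_def)

lemma tokens_map_mem: "A \<subseteq> set p \<Longrightarrow> tokens p (map (\<lambda>v. v \<in> A) p) = A"
  by (force simp: tokens_def set_zip in_set_conv_nth)

lemma card_tokens:
  "length p = length x \<Longrightarrow> distinct p \<Longrightarrow> card (tokens p x) = count_list x True"
proof (induction p x rule: list_induct2)
  case (Cons v p b x)
  moreover have "finite (tokens p x)" "v \<notin> tokens p x"
    using Cons.prems tokens_subset[of p x] by (auto intro: finite_subset)
  ultimately show ?case by (simp add: tokens_Cons)
qed (simp add: tokens_def)

text \<open>Taking the characteristic string along \<open>p\<close> is a left inverse, because a
  vertex occurs at one position only.\<close>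

lemma inj_on_tokens:
  assumes "distinct p"
  shows "inj_on (tokens p) {x. length x = length p}"
proof -
  have "map (\<lambda>v. v \<in> tokens p x) p = x" if "length p = length x" for x
    using that assms
  proof (induction p x rule: list_induct2)
    case (Cons v p b x)
    then have "v \<notin> tokens p x" using tokens_subset[of p x] by auto
    then have hd: "v \<in> tokens (v # p) (b # x) \<longleftrightarrow> b" by (simp add: tokens_Cons)
    have "map (\<lambda>w. w \<in> tokens (v # p) (b # x)) p = map (\<lambda>w. w \<in> tokens p x) p"
      using Cons.prems by (auto simp: tokens_Cons)
    also have "\<dots> = x"
      using Cons.IH Cons.prems by simp
    finally show ?case
      unfolding list.map hd by simp
  qed simp
  then show ?thesis
    by (intro inj_on_inverseI[of _ "\<lambda>A. map (\<lambda>v. v \<in> A) p"]) simp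
qed

lemma tokens_config:
  assumes "distinct p" "length p = s + t"
  shows "tokens p ` config s t = {A. A \<subseteq> set p \<and> card A = t}"
proof (intro equalityI subsetI)
  fix A assume "A \<in> tokens p ` config s t"
  then obtain x where x: "x \<in> config s t" "A = tokens p x" by blast
  then have "length p = length x"
    using assms(2) by (simp add: config_def length_eq_count_bool)
  with x card_tokens[of p x] assms(1) tokens_subset[of p x]
  show "A \<in> {A. A \<subseteq> set p \<and> card A = t}"
    by (simp add: config_def)
next
  fix A assume "A \<in> {A. A \<subseteq> set p \<and> card A = t}"
  then have A: "A \<subseteq> set p" "card A = t" by simp_all
  let ?x = "map (\<lambda>v. v \<in> A) p"
  have "count_list ?x True = t"
    using card_tokens[of p ?x] assms(1) A by (simp add: tokens_map_mem)
  moreover have "length ?x = s + t"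
    using assms(2) by simp
  ultimately have "?x \<in> config s t"
    unfolding config_def length_eq_count_bool by simp
  then show "A \<in> tokens p ` config s t"
    using tokens_map_mem[OF A(1)] by (metis image_eqI)
qed

lemma vwalk_arcs_append: "(c, d) \<in> set (vwalk_arcs (p @ c # d # q))"
  by (induction p rule: vwalk_arcs.induct) auto

text \<open>The swapped bits sit on consecutive vertices of \<open>p\<close>, and one token moves
  between them. \<open>vwalk_arcs p\<close> lists each edge in one direction only, hence the
  disjunction.\<close>

lemma tokens_swap_adj:
  assumes "swap_adj x y" "length x = length p" "distinct p"
  obtains a b where "sym_diff (tokens p x) (tokens p y) = {a, b}" "a \<in> tokens p x" "b \<in> tokens p y"
    "(a, b) \<in> set (vwalk_arcs p) \<or> (b, a) \<in> set (vwalk_arcs p)"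
proof -
  obtain u e v where xy: "x = u @ e # (\<not> e) # v" "y = u @ (\<not> e) # e # v"
    using swap_adjE[OF assms(1)] .
  define q where "q = drop (length u) p"
  have "length q = Suc (Suc (length v))"
    using assms(2) by (simp add: q_def xy)
  then obtain c d r where "q = c # d # r" "length r = length v"
    by (auto simp: length_Suc_conv)
  moreover have "p = take (length u) p @ q" by (simp add: q_def)
  moreover have "length (take (length u) p) = length u"
    using assms(2) by (simp add: xy)
  ultimately obtain p' where p: "p = p' @ c # d # r" "length p' = length u" "length r = length v"
    by metis
  have tokens_p: "tokens p (u @ f # g # v) =
      tokens p' u \<union> (if f then {c} else {}) \<union> (if g then {d} else {}) \<union> tokens r v" for f g
    using p by (auto simp: tokens_def)
  have new: "c \<notin> tokens p' u" "c \<notin> tokens r v" "d \<notin> tokens p' u" "d \<notin> tokens r v" "c \<noteq> d"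
    using assms(3) tokens_subset[of p' u] tokens_subset[of r v] by (auto simp: p)
  have arc: "(c, d) \<in> set (vwalk_arcs p)"
    by (simp add: p vwalk_arcs_append)
  show thesis
  proof (cases e)
    case True
    show ?thesis
      by (rule that[of c d]) (use True new arc in \<open>auto simp: xy tokens_p\<close>)
  next
    case False
    show ?thesis
      by (rule that[of d c]) (use False new arc in \<open>auto simp: xy tokens_p\<close>)
  qed
qed

lemma set_vwalk_arcs_subset:
  "successively (\<lambda>x y. (x, y) \<in> R) p \<Longrightarrow> set (vwalk_arcs p) \<subseteq> R"
  by (induction p rule: vwalk_arcs.induct) auto

theorem theorem15:
  fixes G :: "'a pair_pre_digraph" and n k :: nat
  assumes "pair_graph G"
    and "card (pverts G) = n"
    and "k \<ge> 1"
    and "n \<ge> k + 1"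
    and "\<exists>p. hamiltonian_path p (with_proj G)"
    and "even n"
    and "odd k"
  shows "\<exists>P. hamiltonian_path P (with_proj (token_graph k G))"
proof -
  interpret pair_graph G by fact
  obtain p where p: "distinct p" "set p = pverts G" "set (vwalk_arcs p) \<subseteq> parcs G"
    using assms(5) by (auto simp: hamiltonian_path_def vpath_def vwalk_def)
  have arcs_sym: "(b, a) \<in> parcs G" if "(a, b) \<in> parcs G" for a b
    using that arcs_ends_symmetric[OF pair_sym_arcs] by simp
  have len: "length p = (n - k) + k"
    using p assms(2,4) distinct_card[of p] by simp
  \<comment> \<open>The parities enter here: \<open>n - k\<close> is odd since \<open>n\<close> is
    even and \<open>k\<close> is odd.\<close>
  have "extremal_path (n - k) k"
    using assms(4,6,7) by (intro extremal_pathI) auto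
  then obtain P where P: "P \<noteq> []" "distinct P" "set P = config (n - k) k" "successively swap_adj P"
    unfolding extremal_path_def ham_path_def by blast
  have len_P: "length x = length p" if "x \<in> set P" for x
    using that len by (simp add: P(3) config_def length_eq_count_bool)
  have "finite A" if "A \<subseteq> pverts G" for A
    using that finite_subset pair_finite_verts by blast
  then have verts: "tokens p ` set P = token_verts k G"
    unfolding P(3) tokens_config[OF p(1) len] p(2) token_verts_def by blast
  have "inj_on (tokens p) (set P)"
    by (rule inj_on_subset[OF inj_on_tokens[OF p(1)]]) (use len_P in auto)
  then have distinct: "distinct (map (tokens p) P)"
    using P(2) by (simp add: distinct_map)
  \<comment> \<open>Swaps become arcs of the token graph, so the image of \<open>P\<close> is a
    walk; injectivity and surjectivity, shown above, make it Hamiltonian.\<close>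
  have "(tokens p x, tokens p y) \<in> parcs (token_graph k G)"
    if xy: "x \<in> set P" "y \<in> set P" "swap_adj x y" for x y
  proof -
    obtain a b where "sym_diff (tokens p x) (tokens p y) = {a, b}" "a \<in> tokens p x" "b \<in> tokens p y"
      "(a, b) \<in> set (vwalk_arcs p) \<or> (b, a) \<in> set (vwalk_arcs p)"
      using tokens_swap_adj[OF xy(3) len_P[OF xy(1)] p(1)] .
    moreover from this have "(a, b) \<in> parcs G"
      using p(3) arcs_sym by blast
    moreover have "tokens p x \<in> token_verts k G" "tokens p y \<in> token_verts k G"
      using xy verts by blast+
    ultimately show ?thesis
      unfolding token_graph_def by auto
  qed
  with P(4) have "successively (\<lambda>A B. (A, B) \<in> parcs (token_graph k G)) (map (tokens p) P)"
    unfolding successively_map by (rule successively_mono)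
  then have "set (vwalk_arcs (map (tokens p) P)) \<subseteq> parcs (token_graph k G)"
    by (rule set_vwalk_arcs_subset)
  with P(1) distinct verts have "hamiltonian_path (map (tokens p) P) (with_proj (token_graph k G))"
    by (auto simp: hamiltonian_path_def vpath_def vwalk_def token_graph_def)
  then show ?thesis by blast
qed

end
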